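(* The map $\rho:C_n\to\mathrm{GL}(V_n)$ defined on the generators $\sigma_1,\dots,\sigma_{n-1},\alpha_1,\dots,\alpha_{n-1}$ of $C_n$ as described in the context (Lawrence–Krammer action of the $\sigma_i$ and permutation action of the $\alpha_i$) is a linear representation if and only if $t=1$.
   Context: $F_n$ is the free group on $x_1,\dots,x_n$; $C_n\le\mathrm{Aut}(F_n)$ is the group of conjugating automorphisms, i.e. those sending each $x_i$ to $f_i^{-1}x_{\pi(i)}f_i$ with $f_i\in F_n$, $\pi\in S_n$. It is generated by $\sigma_i: x_i\mapsto x_ix_{i+1}x_i^{-1},\ x_{i+1}\mapsto x_i,\ x_l\mapsto x_l$ ($l\ne i,i+1$) and $\alpha_i: x_i\mapsto x_{i+1},\ x_{i+1}\mapsto x_i,\ x_l\mapsto x_l$ ($l\ne i,i+1$), $1\le i\le n-1$. Products of automorphisms are read from left to right, and the action on modules is a right action ($v^{gh}=(v^g)^h$). $V_n$ is the free module of rank $n(n-1)/2$ with basis $v_{ij}$, $1\le i<j\le n$, over the ring $\mathbb{Z}[t^{\pm1},q^{\pm1}]$ of Laurent polynomials in two variables; $t$ and $q$ are the parameters of the representation, and the condition $t=1$ refers to giving the parameter $t$ the value $1$. The map $\rho$ is given on generators by: $\sigma_i$: $v_{k,i}\mapsto(1-q)v_{k,i}+qv_{k,i+1}+q(q-1)v_{i,i+1}$ and $v_{k,i+1}\mapsto v_{k,i}$ for $k<i$; $v_{i,i+1}\mapsto tq^2v_{i,i+1}$; $v_{i,l}\mapsto tq(q-1)v_{i,i+1}+(1-q)v_{i,l}+qv_{i+1,l}$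 and $v_{i+1,l}\mapsto v_{i,l}$ for $l>i+1$; $v_{k,l}\mapsto v_{k,l}$ if $\{k,l\}\cap\{i,i+1\}=\emptyset$. $\alpha_i$: $v_{k,i}\mapsto v_{k,i+1}$ and $v_{k,i+1}\mapsto v_{k,i}$ for $k<i$; $v_{i,i+1}\mapsto v_{i,i+1}$; $v_{i,l}\mapsto v_{i+1,l}$ and $v_{i+1,l}\mapsto v_{i,l}$ for $l>i+1$; $v_{k,l}\mapsto v_{k,l}$ if $\{k,l\}\cap\{i,i+1\}=\emptyset$.
   Formalization: The formal statement assumes n ≥ 3: for n = 1 the group and module are trivial, and for n = 2 the group C_2 is the free product of ⟨σ_1⟩ ≅ Z and ⟨α_1⟩ ≅ Z/2, so ρ is a representation for every t and the "only if" fails. *)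

theory Defs
  imports
    "HOL-Algebra.Bij"
    "HOL-Combinatorics.Permutations"
    "HOL-Library.Poly_Mapping"
begin

section \<open>The free group on x_1, ..., x_n\<close>

text \<open>
  The letter \<open>(i, True)\<close> is x_i and \<open>(i, False)\<close> is its inverse; elements of the
  free group are reduced words.
\<close>

type_synonym letter = "nat \<times> bool"

definition inverse_letters :: "letter \<Rightarrow> letter \<Rightarrow> bool" where
  "inverse_letters a b \<longleftrightarrow> fst a = fst b \<and> snd a \<noteq> snd b"

definition reduced :: "letter list \<Rightarrow> bool" where
  "reduced w \<longleftrightarrow> successively (\<lambda>a b. \<not> inverse_letters a b) w"

text \<open>Left multiplication of a reduced word by one letter.\<close>

fun push_letter :: "letter \<Rightarrow> letter list \<Rightarrow> letter list" where
  "push_letter a [] = [a]"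
| "push_letter a (b # w) = (if inverse_letters a b then w else a # b # w)"

definition free_group :: "nat \<Rightarrow> letter list monoid" where
  "free_group n =
    \<lparr>carrier = {w. set w \<subseteq> {1..n} \<times> UNIV \<and> reduced w},
     monoid.mult = \<lambda>u v. foldr push_letter u v,
     one = []\<rparr>"

definition gen :: "nat \<Rightarrow> letter list" where
  "gen i = [(i, True)]"

lemma reduced_Cons:
  "reduced (a # w) \<longleftrightarrow> reduced w \<and> (w = [] \<or> \<not> inverse_letters a (hd w))"
  by (cases w) (auto simp: reduced_def)

lemma reduced_Nil [simp]: "reduced []"
  by (simp add: reduced_def)

lemma reduced_push: "reduced w \<Longrightarrow> reduced (push_letter a w)"
  by (cases w) (auto simp: reduced_Cons)

lemma reduced_foldr_push: "reduced w \<Longrightarrow> reduced (foldr push_letter u w)"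
  by (induction u) (auto simp: reduced_push)

lemma set_push: "set (push_letter a w) \<subseteq> insert a (set w)"
  by (cases w) auto

lemma set_foldr_push: "set (foldr push_letter u w) \<subseteq> set u \<union> set w"
proof (induction u)
  case (Cons a u)
  then show ?case using set_push[of a "foldr push_letter u w"] by auto
qed simp

lemma push_cancel:
  assumes "inverse_letters a b" "reduced w"
  shows "push_letter a (push_letter b w) = w"
proof (cases w)
  case Nil
  then show ?thesis using assms by simp
next
  case (Cons c v)
  show ?thesis
  proof (cases "inverse_letters b c")
    case True
    then have "a = c"
      using assms(1) by (auto simp: inverse_letters_def prod_eq_iff)
    then show ?thesis
      using True Cons assms(2) by (cases v) (auto simp: reduced_Cons)
  next
    case False
    then show ?thesis using Cons assms(1) by simp
  qed
qed

lemma foldr_push_push: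
  assumes "reduced w"
  shows "foldr push_letter (push_letter a u) w = push_letter a (foldr push_letter u w)"
proof (cases u)
  case (Cons b v)
  then show ?thesis
    using push_cancel[of a b "foldr push_letter v w"] assms
    by (auto simp: reduced_foldr_push)
qed simp

lemma foldr_push_assoc:
  assumes "reduced w"
  shows "foldr push_letter (foldr push_letter u v) w =
         foldr push_letter u (foldr push_letter v w)"
  by (induction u) (simp_all add: foldr_push_push assms)

lemma foldr_push_Nil: "reduced w \<Longrightarrow> foldr push_letter w [] = w"
proof (induction w)
  case (Cons a w)
  then show ?case by (cases w) (auto simp: reduced_Cons)
qed simp

lemma foldr_push_inverse:
  "foldr push_letter (map (apsnd Not) (rev w)) (foldr push_letter w []) = []"
proof (induction w)
  case (Cons a w)
  have "inverse_letters (apsnd Not a) a"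
    by (cases a) (simp add: inverse_letters_def)
  then have "push_letter (apsnd Not a) (push_letter a (foldr push_letter w [])) =
      foldr push_letter w []"
    by (rule push_cancel) (simp add: reduced_foldr_push)
  with Cons show ?case by simp
qed simp

lemma group_free_group: "group (free_group n)"
proof (rule groupI)
  fix u v assume "u \<in> carrier (free_group n)" "v \<in> carrier (free_group n)"
  then show "u \<otimes>\<^bsub>free_group n\<^esub> v \<in> carrier (free_group n)"
    using set_foldr_push[of u v] by (auto simp: free_group_def reduced_foldr_push)
next
  show "\<one>\<^bsub>free_group n\<^esub> \<in> carrier (free_group n)"
    by (simp add: free_group_def)
next
  fix u v w
  assume "w \<in> carrier (free_group n)"
  then show "u \<otimes>\<^bsub>free_group n\<^esub> v \<otimes>\<^bsub>free_group n\<^esub> w =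
      u \<otimes>\<^bsub>free_group n\<^esub> (v \<otimes>\<^bsub>free_group n\<^esub> w)"
    by (simp add: free_group_def foldr_push_assoc)
next
  fix w assume "w \<in> carrier (free_group n)"
  then show "\<one>\<^bsub>free_group n\<^esub> \<otimes>\<^bsub>free_group n\<^esub> w = w"
    by (simp add: free_group_def)
next
  fix w assume w: "w \<in> carrier (free_group n)"
  define u where "u = foldr push_letter (map (apsnd Not) (rev w)) []"
  have "set (map (apsnd Not) (rev w)) \<subseteq> {1..n} \<times> UNIV"
    using w by (auto simp: free_group_def)
  then have "set u \<subseteq> {1..n} \<times> UNIV"
    unfolding u_def by (intro order_trans[OF set_foldr_push]) (simp only: list.set Un_empty_right)
  then have "u \<in> carrier (free_group n)"
    by (simp add: free_group_def u_def reduced_foldr_push)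
  moreover have "u \<otimes>\<^bsub>free_group n\<^esub> w = \<one>\<^bsub>free_group n\<^esub>"
    using w foldr_push_inverse[of w]
    by (simp add: free_group_def u_def foldr_push_assoc foldr_push_Nil)
  ultimately show "\<exists>y\<in>carrier (free_group n). y \<otimes>\<^bsub>free_group n\<^esub> w = \<one>\<^bsub>free_group n\<^esub>"
    by blast
qed


section \<open>Conjugating automorphisms\<close>

text \<open>
  Products are read from left to right, i.e. \<open>g \<otimes> h\<close> means first g, then h.
  (The library group \<open>AutoGroup\<close> composes in the opposite order.)
\<close>

definition conj_aut_group :: "nat \<Rightarrow> (letter list \<Rightarrow> letter list) monoid" where
  "conj_aut_group n =
    \<lparr>carrier = {\<phi> \<in> auto (free_group n). \<exists>\<pi>. \<pi> permutes {1..n} \<and>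
       (\<forall>i\<in>{1..n}. \<exists>f\<in>carrier (free_group n).
          \<phi> (gen i) = inv\<^bsub>free_group n\<^esub> f \<otimes>\<^bsub>free_group n\<^esub> gen (\<pi> i) \<otimes>\<^bsub>free_group n\<^esub> f)},
     monoid.mult = \<lambda>g h. compose (carrier (free_group n)) h g,
     one = (\<lambda>w\<in>carrier (free_group n). w)\<rparr>"

text \<open>The endomorphism of the free group sending each x_i to \<open>f i\<close>.\<close>

definition free_endo :: "nat \<Rightarrow> (nat \<Rightarrow> letter list) \<Rightarrow> letter list \<Rightarrow> letter list" where
  "free_endo n f = (\<lambda>w\<in>carrier (free_group n).
     foldr (\<lambda>(i, e) u. (if e then f i else inv\<^bsub>free_group n\<^esub> (f i)) \<otimes>\<^bsub>free_group n\<^esub> u)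
       w \<one>\<^bsub>free_group n\<^esub>)"

definition sigma :: "nat \<Rightarrow> nat \<Rightarrow> letter list \<Rightarrow> letter list" where
  "sigma n i = free_endo n (\<lambda>l.
     if l = i then
       gen i \<otimes>\<^bsub>free_group n\<^esub> gen (i + 1) \<otimes>\<^bsub>free_group n\<^esub> inv\<^bsub>free_group n\<^esub> (gen i)
     else if l = i + 1 then gen i
     else gen l)"

definition alpha :: "nat \<Rightarrow> nat \<Rightarrow> letter list \<Rightarrow> letter list" where
  "alpha n i = free_endo n (\<lambda>l.
     if l = i then gen (i + 1)
     else if l = i + 1 then gen i
     else gen l)"


section \<open>Laurent polynomials\<close>

text \<open>
  The group ring of the integers over \<open>'a\<close>. The multiplication of \<open>\<Rightarrow>\<^sub>0\<close> is convolution,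
  so \<open>Poly_Mapping.single k c\<close> is c times the k-th power of the variable.
\<close>

type_synonym 'a laurent = "int \<Rightarrow>\<^sub>0 'a"

text \<open>Laurent polynomials in t and q over the integers, seen as polynomials in q over
  the Laurent polynomials in t.\<close>

type_synonym laurent_tq = "int laurent laurent"

definition var_t :: laurent_tq where
  "var_t = Poly_Mapping.single 0 (Poly_Mapping.single 1 1)"

text \<open>The variable q of the Laurent polynomials over an arbitrary ring.\<close>

definition var_q :: "'a::comm_ring_1 laurent" where
  "var_q = Poly_Mapping.single 1 1"

text \<open>
  Giving the parameter t a value while keeping q an indeterminate: a ring homomorphism
  \<open>\<phi>\<close> into some ring of Laurent polynomials in q that fixes q. The value of t is \<open>\<phi> var_t\<close>,
  automatically a unit. The identity leaves t an indeterminate; \<open>'a = int\<close> and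
  \<open>\<phi> var_t = 1\<close> is the specialization t = 1.
\<close>

definition specialization :: "(laurent_tq \<Rightarrow> 'a::comm_ring_1 laurent) \<Rightarrow> bool" where
  "specialization \<phi> \<longleftrightarrow>
     (\<forall>x y. \<phi> (x + y) = \<phi> x + \<phi> y) \<and>
     (\<forall>x y. \<phi> (x * y) = \<phi> x * \<phi> y) \<and>
     \<phi> 1 = 1 \<and>
     \<phi> var_q = var_q"


section \<open>The module V_n and its general linear group\<close>

definition basis_index :: "nat \<Rightarrow> (nat \<times> nat) set" where
  "basis_index n = {(i, j). 1 \<le> i \<and> i < j \<and> j \<le> n}"

text \<open>Vectors are given by their coordinates with respect to the basis v_ij.\<close>

definition V :: "nat \<Rightarrow> (nat \<times> nat \<Rightarrow> 'a::comm_ring_1) set" where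
  "V n = {x. \<forall>b. b \<notin> basis_index n \<longrightarrow> x b = 0}"

definition basis_vec :: "nat \<Rightarrow> nat \<Rightarrow> nat \<times> nat \<Rightarrow> 'a::comm_ring_1" where
  "basis_vec i j = (\<lambda>b. if b = (i, j) then 1 else 0)"

text \<open>As GL acts from the right, \<open>g \<otimes> h\<close> again means first g, then h.\<close>

definition GL :: "nat \<Rightarrow> ((nat \<times> nat \<Rightarrow> 'a::comm_ring_1) \<Rightarrow> (nat \<times> nat \<Rightarrow> 'a)) monoid" where
  "GL n =
    \<lparr>carrier = {g \<in> Bij (V n).
       (\<forall>x\<in>V n. \<forall>y\<in>V n. g (\<lambda>b. x b + y b) = (\<lambda>b. g x b + g y b)) \<and>
       (\<forall>c. \<forall>x\<in>V n. g (\<lambda>b. c * x b) = (\<lambda>b. c * g x b))},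
     monoid.mult = \<lambda>g h. compose (V n) h g,
     one = (\<lambda>x\<in>V n. x)\<rparr>"

text \<open>The linear map sending each basis vector v_kl to \<open>m k l\<close>.\<close>

definition linear_ext ::
  "nat \<Rightarrow> (nat \<Rightarrow> nat \<Rightarrow> nat \<times> nat \<Rightarrow> 'a::comm_ring_1) \<Rightarrow>
   (nat \<times> nat \<Rightarrow> 'a) \<Rightarrow> (nat \<times> nat \<Rightarrow> 'a)" where
  "linear_ext n m = (\<lambda>x\<in>V n. \<lambda>b. \<Sum>(k, l)\<in>basis_index n. x (k, l) * m k l b)"

text \<open>In the first branch below l = i, so k < i because k < l. Likewise l > i + 1 in the
  fourth and fifth branches.\<close>

definition rho_sigma ::
  "nat \<Rightarrow> 'a::comm_ring_1 \<Rightarrow> 'a \<Rightarrow> nat \<Rightarrow> (nat \<times> nat \<Rightarrow> 'a) \<Rightarrow> (nat \<times> nat \<Rightarrow> 'a)" where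
  "rho_sigma n t q i = linear_ext n (\<lambda>k l b.
     if l = i then
       (1 - q) * basis_vec k i b + q * basis_vec k (i + 1) b
         + q * (q - 1) * basis_vec i (i + 1) b
     else if k < i \<and> l = i + 1 then basis_vec k i b
     else if k = i \<and> l = i + 1 then t * q\<^sup>2 * basis_vec i (i + 1) b
     else if k = i then
       t * q * (q - 1) * basis_vec i (i + 1) b + (1 - q) * basis_vec i l b
         + q * basis_vec (i + 1) l b
     else if k = i + 1 then basis_vec i l b
     else basis_vec k l b)"

definition rho_alpha ::
  "nat \<Rightarrow> nat \<Rightarrow> (nat \<times> nat \<Rightarrow> 'a::comm_ring_1) \<Rightarrow> (nat \<times> nat \<Rightarrow> 'a)" where
  "rho_alpha n i = linear_ext n (\<lambda>k l.
     if l = i then basis_vec k (i + 1)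
     else if k < i \<and> l = i + 1 then basis_vec k i
     else if k = i \<and> l = i + 1 then basis_vec i (i + 1)
     else if k = i then basis_vec (i + 1) l
     else if k = i + 1 then basis_vec i l
     else basis_vec k l)"

end

theory Submission
  imports Defs
begin

text \<open>
  Why t = 1 is sufficient. The representation at t = 1 is the action on squares in the Burau
  representation, and the latter is defined intrinsically for every conjugating automorphism,
  so that multiplicativity is a chain rule instead of a check of relations. The Burau matrix of
  an automorphism g has as row i the Fox derivatives of g(x_i), with all generators evaluated at
  q. If g is conjugating, then g(x_i) has exponent sum 1. By the chain rule
  (\<open>chain_rule\<close>) the matrix is multiplicative in g, and by the fundamental formula of Fox
  calculus its rows have sum 1 (\<open>burau_row_sum\<close>). Such matrices preserve the span of the
  differences e_k - e_l, and \<open>w \<otimes> w\<close> for w in that span is a combination of the tensors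
  \<open>(e_k - e_l) \<otimes> (e_k - e_l)\<close>, so their span is preserved as well. These tensors are
  linearly independent over every ring, because the entry at (k, l) above the diagonal is -1 for
  the tensor of the pair (k, l) and 0 for the other pairs. Identifying them with the v_kl gives
  an action on V_n (\<open>square_substitute\<close>, \<open>quadratic_action_compose\<close>), and
  expanding squares shows that sigma_i and alpha_i act by the required formulas
  (\<open>quadratic_action_burau_sigma\<close>, \<open>quadratic_action_burau_alpha\<close>).

  Why t = 1 is necessary. In the group one has alpha_1 alpha_2 sigma_1 = sigma_2 alpha_1 alpha_2
  (\<open>alpha_alpha_sigma\<close>). Applied to v_12, the coefficients of v_12 on the two sides are
  t q (q - 1) and q (q - 1). As q is a unit and q - 1 is not a zero divisor among Laurent
  polynomials in q (\<open>var_q_minus_one_cancel\<close>), t = 1 follows.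
\<close>

section \<open>The universal property of the free group\<close>

text \<open>
  The multiplication of the free group cancels letters, so an evaluation of words by a fold is
  multiplicative as soon as inverse letters act by inverse maps. Both the endomorphisms
  \<open>free_endo\<close> and the Fox derivatives below are such folds.
\<close>
lemma foldr_push_letter_action:
  assumes "\<And>a x. a \<in> A \<Longrightarrow> x \<in> X \<Longrightarrow> h a x \<in> X"
    and "\<And>a b x. a \<in> A \<Longrightarrow> b \<in> A \<Longrightarrow> x \<in> X \<Longrightarrow> inverse_letters a b \<Longrightarrow> h a (h b x) = x"
    and "set u \<subseteq> A" "set v \<subseteq> A" "x \<in> X"
  shows "foldr h (foldr push_letter u v) x = foldr h u (foldr h v x)"
proof -
  have closed: "foldr h w x \<in> X" if "set w \<subseteq> A" for w
    using that assms(1,5) by (induction w) auto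
  have push: "foldr h (push_letter a w) x = h a (foldr h w x)"
    if "a \<in> A" "set w \<subseteq> A" for a w
    using that assms(2) closed by (cases w) auto
  show ?thesis
    using assms(3)
  proof (induction u)
    case (Cons a u)
    moreover have "set (foldr push_letter u v) \<subseteq> A"
      using set_foldr_push[of u v] Cons.prems assms(4) by auto
    ultimately show ?case by (simp add: push)
  qed simp
qed

lemma mult_free_group: "u \<otimes>\<^bsub>free_group n\<^esub> v = foldr push_letter u v"
  by (simp add: free_group_def)

lemma one_free_group: "\<one>\<^bsub>free_group n\<^esub> = []"
  by (simp add: free_group_def)

lemma mem_free_group:
  "w \<in> carrier (free_group n) \<longleftrightarrow> set w \<subseteq> {1..n} \<times> UNIV \<and> reduced w"
  by (simp add: free_group_def)

lemma letter_in_free_group: "i \<in> {1..n} \<Longrightarrow> [(i, e)] \<in> carrier (free_group n)"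
  by (simp add: mem_free_group reduced_def)

lemma gen_in_free_group [simp]: "i \<in> {1..n} \<Longrightarrow> gen i \<in> carrier (free_group n)"
  unfolding gen_def by (rule letter_in_free_group)

lemma inv_gen: "i \<in> {1..n} \<Longrightarrow> inv\<^bsub>free_group n\<^esub> gen i = [(i, False)]"
  by (rule group.inv_equality[OF group_free_group])
     (simp_all add: letter_in_free_group, simp add: gen_def mult_free_group one_free_group inverse_letters_def)

lemma free_group_induct [consumes 1, case_names one gen inv_gen]:
  assumes "w \<in> carrier (free_group n)"
    and "P \<one>\<^bsub>free_group n\<^esub>"
    and "\<And>i u. i \<in> {1..n} \<Longrightarrow> u \<in> carrier (free_group n) \<Longrightarrow> P u
          \<Longrightarrow> P (gen i \<otimes>\<^bsub>free_group n\<^esub> u)"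
    and "\<And>i u. i \<in> {1..n} \<Longrightarrow> u \<in> carrier (free_group n) \<Longrightarrow> P u
          \<Longrightarrow> P (inv\<^bsub>free_group n\<^esub> gen i \<otimes>\<^bsub>free_group n\<^esub> u)"
  shows "P w"
  using assms(1)
proof (induction w)
  case Nil
  then show ?case using assms(2) by (simp add: one_free_group)
next
  case (Cons a w)
  obtain i e where a: "a = (i, e)" by (cases a)
  have i: "i \<in> {1..n}" and w: "w \<in> carrier (free_group n)"
    using Cons.prems by (auto simp: a mem_free_group reduced_Cons)
  have "a # w = [a] \<otimes>\<^bsub>free_group n\<^esub> w"
    using Cons.prems by (cases w) (auto simp: mult_free_group mem_free_group reduced_Cons)
  moreover have "[a] = (if e then gen i else inv\<^bsub>free_group n\<^esub> gen i)"
    using i by (simp add: a gen_def inv_gen[unfolded gen_def])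
  ultimately show ?case
    using assms(3,4)[OF i w Cons.IH[OF w]] by (cases e) auto
qed

lemma hom_free_group_eqI:
  assumes G: "group G" and g: "g \<in> hom (free_group n) G" and h: "h \<in> hom (free_group n) G"
    and eq: "\<And>i. i \<in> {1..n} \<Longrightarrow> g (gen i) = h (gen i)"
    and w: "w \<in> carrier (free_group n)"
  shows "g w = h w"
proof -
  interpret g: group_hom "free_group n" G g
    using G g by (simp add: group_hom_def group_hom_axioms_def group_free_group)
  interpret h: group_hom "free_group n" G h
    using G h by (simp add: group_hom_def group_hom_axioms_def group_free_group)
  show ?thesis
    using w by (induction w rule: free_group_induct) (simp_all add: eq)
qed

lemma free_endo_hom:
  assumes f: "\<And>i. i \<in> {1..n} \<Longrightarrow> f i \<in> carrier (free_group n)"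
  shows "free_endo n f \<in> hom (free_group n) (free_group n)"
proof -
  interpret F: group "free_group n" by (rule group_free_group)
  define h where "h = (\<lambda>(i, e) u. (if e then f i else inv\<^bsub>free_group n\<^esub> (f i)) \<otimes>\<^bsub>free_group n\<^esub> u)"
  let ?A = "{1..n} \<times> (UNIV :: bool set)" and ?X = "carrier (free_group n)"
  have closed: "h a x \<in> ?X" if "a \<in> ?A" "x \<in> ?X" for a x
    using that f by (auto simp: h_def)
  have cancel: "h a (h b x) = x"
    if "a \<in> ?A" "b \<in> ?A" "x \<in> ?X" "inverse_letters a b" for a b x
    using that f by (auto simp: h_def inverse_letters_def F.m_assoc[symmetric])
  have foldr_closed: "foldr h w x \<in> ?X" if "set w \<subseteq> ?A" "x \<in> ?X" for w x
    using that by (induction w) (auto intro!: closed simp del: SigmaE)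
  have foldr_one: "foldr h w x = foldr h w \<one>\<^bsub>free_group n\<^esub> \<otimes>\<^bsub>free_group n\<^esub> x"
    if "set w \<subseteq> ?A" "x \<in> ?X" for w x
    using that
  proof (induction w)
    case (Cons a w)
    then show ?case
      using f foldr_closed[of w "\<one>\<^bsub>free_group n\<^esub>"] by (auto simp: h_def F.m_assoc)
  qed simp
  have endo: "free_endo n f = (\<lambda>w\<in>?X. foldr h w \<one>\<^bsub>free_group n\<^esub>)"
    by (simp add: free_endo_def h_def)
  show ?thesis
  proof (rule homI)
    fix u assume "u \<in> ?X"
    then show "free_endo n f u \<in> ?X"
      by (simp add: endo foldr_closed mem_free_group[of u])
  next
    fix u v assume uv: "u \<in> ?X" "v \<in> ?X"
    then have sets: "set u \<subseteq> ?A" "set v \<subseteq> ?A" by (simp_all add: mem_free_group)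
    have "foldr h (u \<otimes>\<^bsub>free_group n\<^esub> v) \<one>\<^bsub>free_group n\<^esub>
        = foldr h u (foldr h v \<one>\<^bsub>free_group n\<^esub>)"
      unfolding mult_free_group
      by (rule foldr_push_letter_action[OF closed cancel sets F.one_closed])
    also have "\<dots> = foldr h u \<one>\<^bsub>free_group n\<^esub> \<otimes>\<^bsub>free_group n\<^esub> foldr h v \<one>\<^bsub>free_group n\<^esub>"
      using foldr_one sets foldr_closed by blast
    finally show "free_endo n f (u \<otimes>\<^bsub>free_group n\<^esub> v)
        = free_endo n f u \<otimes>\<^bsub>free_group n\<^esub> free_endo n f v"
      using uv by (simp add: endo)
  qed
qed

lemma free_endo_gen:
  assumes "i \<in> {1..n}" "f i \<in> carrier (free_group n)"
  shows "free_endo n f (gen i) = f i"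
proof -
  interpret F: group "free_group n" by (rule group_free_group)
  have "foldr (\<lambda>(i, e) u. (if e then f i else inv\<^bsub>free_group n\<^esub> (f i)) \<otimes>\<^bsub>free_group n\<^esub> u)
      (gen i) \<one>\<^bsub>free_group n\<^esub> = f i \<otimes>\<^bsub>free_group n\<^esub> \<one>\<^bsub>free_group n\<^esub>"
    by (simp add: gen_def)
  then show ?thesis
    using assms gen_in_free_group[OF assms(1)] by (simp add: free_endo_def)
qed

text \<open>
  Bijectivity of an endomorphism is checked on generators, by exhibiting an inverse there: the
  two compositions are then homomorphisms that agree with the identity on the generators.
\<close>
lemma auto_free_groupI:
  assumes g: "g \<in> hom (free_group n) (free_group n)" "g \<in> extensional (carrier (free_group n))"
    and h: "h \<in> hom (free_group n) (free_group n)"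
    and hg: "\<And>i. i \<in> {1..n} \<Longrightarrow> h (g (gen i)) = gen i"
    and gh: "\<And>i. i \<in> {1..n} \<Longrightarrow> g (h (gen i)) = gen i"
  shows "g \<in> auto (free_group n)"
proof -
  let ?F = "free_group n"
  have eval: "k w = w" if "k \<in> hom ?F ?F" "\<And>i. i \<in> {1..n} \<Longrightarrow> k (gen i) = gen i"
      "w \<in> carrier ?F" for k w
    using hom_free_group_eqI[OF group_free_group that(1), of id] that(2,3)
    by (simp add: hom_def)
  have "h (g w) = w" if "w \<in> carrier ?F" for w
    using eval[of "h \<circ> g"] hom_compose[OF g(1) h] hg that by simp
  moreover have "g (h w) = w" if "w \<in> carrier ?F" for w
    using eval[of "g \<circ> h"] hom_compose[OF h g(1)] gh that by simp
  ultimately have "bij_betw g (carrier ?F) (carrier ?F)"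
    using g(1) h by (intro bij_betwI[of g _ _ h]) (auto simp: hom_def)
  then show ?thesis
    using g by (simp add: auto_def Bij_def)
qed

section \<open>The group of conjugating automorphisms\<close>

lemma sigma_hom: "i \<in> {1..<n} \<Longrightarrow> sigma n i \<in> hom (free_group n) (free_group n)"
  unfolding sigma_def
  by (rule free_endo_hom) (auto intro!: monoid.m_closed group.inv_closed group_free_group group.is_monoid)

lemma alpha_hom: "i \<in> {1..<n} \<Longrightarrow> alpha n i \<in> hom (free_group n) (free_group n)"
  unfolding alpha_def by (rule free_endo_hom) auto

lemma sigma_gen:
  assumes "i \<in> {1..<n}" "k \<in> {1..n}"
  shows "sigma n i (gen k) =
    (if k = i then gen i \<otimes>\<^bsub>free_group n\<^esub> gen (i + 1) \<otimes>\<^bsub>free_group n\<^esub> inv\<^bsub>free_group n\<^esub> gen i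
     else if k = i + 1 then gen i else gen k)"
  using assms unfolding sigma_def
  by (subst free_endo_gen)
     (auto intro!: monoid.m_closed group.inv_closed group_free_group group.is_monoid)

lemma alpha_gen:
  assumes "i \<in> {1..<n}" "k \<in> {1..n}"
  shows "alpha n i (gen k) = (if k = i then gen (i + 1) else if k = i + 1 then gen i else gen k)"
  using assms unfolding alpha_def by (subst free_endo_gen) auto

lemma sigma_extensional: "sigma n i \<in> extensional (carrier (free_group n))"
  by (simp add: sigma_def free_endo_def)

lemma alpha_extensional: "alpha n i \<in> extensional (carrier (free_group n))"
  by (simp add: alpha_def free_endo_def)

lemma conj_aut_groupI:
  assumes "g \<in> auto (free_group n)" "\<pi> permutes {1..n}"
    and "\<And>i. i \<in> {1..n} \<Longrightarrow> f i \<in> carrier (free_group n)"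
    and "\<And>i. i \<in> {1..n} \<Longrightarrow> g (gen i) =
      inv\<^bsub>free_group n\<^esub> f i \<otimes>\<^bsub>free_group n\<^esub> gen (\<pi> i) \<otimes>\<^bsub>free_group n\<^esub> f i"
  shows "g \<in> carrier (conj_aut_group n)"
proof -
  have "\<forall>i\<in>{1..n}. \<exists>f\<in>carrier (free_group n). g (gen i) =
      inv\<^bsub>free_group n\<^esub> f \<otimes>\<^bsub>free_group n\<^esub> gen (\<pi> i) \<otimes>\<^bsub>free_group n\<^esub> f"
    using assms(3,4) by blast
  then show ?thesis
    using assms(1,2) unfolding conj_aut_group_def by auto
qed

lemma sigma_in_conj_aut_group:
  assumes i: "i \<in> {1..<n}"
  shows "sigma n i \<in> carrier (conj_aut_group n)"
proof -
  interpret F: group "free_group n" by (rule group_free_group)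
  let ?F = "free_group n"
  have gens: "gen i \<in> carrier ?F" "gen (i + 1) \<in> carrier ?F" "gen (Suc i) \<in> carrier ?F"
    using i by auto
  have cancel: "x \<otimes>\<^bsub>?F\<^esub> (inv\<^bsub>?F\<^esub> x \<otimes>\<^bsub>?F\<^esub> y) = y"
      "inv\<^bsub>?F\<^esub> x \<otimes>\<^bsub>?F\<^esub> (x \<otimes>\<^bsub>?F\<^esub> y) = y"
    if "x \<in> carrier ?F" "y \<in> carrier ?F" for x y
    using that by (simp_all add: F.m_assoc[symmetric])
  \<comment> \<open>The images of the generators under the inverse of \<open>sigma n i\<close>.\<close>
  define f where "f = (\<lambda>l. if l = i then gen (i + 1)
     else if l = i + 1 then inv\<^bsub>?F\<^esub> gen (i + 1) \<otimes>\<^bsub>?F\<^esub> gen i \<otimes>\<^bsub>?F\<^esub> gen (i + 1) else gen l)"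
  have f: "f l \<in> carrier ?F" if "l \<in> {1..n}" for l
    using that gens by (auto simp: f_def)
  note tau_gen = free_endo_gen[of _ n f, OF _ f]
  interpret s: group_hom ?F ?F "sigma n i"
    using sigma_hom[OF i] by unfold_locales
  interpret t: group_hom ?F ?F "free_endo n f"
    using free_endo_hom[of n f, OF f] by unfold_locales
  have "sigma n i \<in> auto ?F"
  proof (rule auto_free_groupI)
    fix k assume k: "k \<in> {1..n}"
    have "gen k \<in> carrier ?F" using k by simp
    have "i \<in> {1..n}" "i + 1 \<in> {1..n}" using i by auto
    then show "free_endo n f (sigma n i (gen k)) = gen k"
      using i k gens
      by (simp add: sigma_gen tau_gen F.m_assoc)
         (simp add: f_def F.m_assoc F.inv_mult_group cancel)
    show "sigma n i (free_endo n f (gen k)) = gen k"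
      using i k gens
      by (simp add: tau_gen) (simp add: f_def sigma_gen F.m_assoc F.inv_mult_group cancel)
  qed (use i in \<open>simp_all add: sigma_hom free_endo_hom f sigma_extensional\<close>)
  then show ?thesis
  \<comment> \<open>The conjugator of x_i is its own inverse letter, since x_i is sent to
    x_i x_{i+1} x_i^{-1}; all the other conjugators are trivial.\<close>
  proof (rule conj_aut_groupI[where \<pi> = "transpose i (i + 1)"
        and f = "\<lambda>k. if k = i then inv\<^bsub>?F\<^esub> gen i else \<one>\<^bsub>?F\<^esub>"])
    show "transpose i (i + 1) permutes {1..n}"
      using i by (intro permutes_swap_id) auto
  qed (use i gens in \<open>auto simp: sigma_gen transpose_def\<close>)
qed

lemma alpha_in_conj_aut_group:
  assumes i: "i \<in> {1..<n}"
  shows "alpha n i \<in> carrier (conj_aut_group n)"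
proof -
  interpret F: group "free_group n" by (rule group_free_group)
  have "alpha n i \<in> auto (free_group n)"
  proof (rule auto_free_groupI)
    show "alpha n i (alpha n i (gen k)) = gen k" if "k \<in> {1..n}" for k
      using i that by (auto simp: alpha_gen)
    then show "alpha n i (alpha n i (gen k)) = gen k" if "k \<in> {1..n}" for k
      using that .
  qed (use i in \<open>simp_all add: alpha_hom alpha_extensional\<close>)
  then show ?thesis
  proof (rule conj_aut_groupI[where \<pi> = "transpose i (i + 1)" and f = "\<lambda>_. \<one>\<^bsub>free_group n\<^esub>"])
    show "transpose i (i + 1) permutes {1..n}"
      using i by (intro permutes_swap_id) auto
  qed (use i in \<open>auto simp: alpha_gen transpose_def\<close>)
qed

lemma mult_conj_aut_group:
  "g \<otimes>\<^bsub>conj_aut_group n\<^esub> h = compose (carrier (free_group n)) h g"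
  by (simp add: conj_aut_group_def)

lemma conj_aut_groupE:
  assumes "g \<in> carrier (conj_aut_group n)"
  obtains \<pi> f where "\<pi> permutes {1..n}"
    and "\<And>i. i \<in> {1..n} \<Longrightarrow> \<pi> i \<in> {1..n}"
    and "\<And>i. i \<in> {1..n} \<Longrightarrow> f i \<in> carrier (free_group n)"
    and "\<And>i. i \<in> {1..n} \<Longrightarrow> g (gen i) =
      inv\<^bsub>free_group n\<^esub> f i \<otimes>\<^bsub>free_group n\<^esub> gen (\<pi> i) \<otimes>\<^bsub>free_group n\<^esub> f i"
proof -
  obtain \<pi> where \<pi>: "\<pi> permutes {1..n}" and
    f: "\<forall>i\<in>{1..n}. \<exists>f\<in>carrier (free_group n).
        g (gen i) = inv\<^bsub>free_group n\<^esub> f \<otimes>\<^bsub>free_group n\<^esub> gen (\<pi> i) \<otimes>\<^bsub>free_group n\<^esub> f"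
    using assms(1) unfolding conj_aut_group_def by auto
  have "\<pi> i \<in> {1..n}" if "i \<in> {1..n}" for i
    using permutes_in_image[OF \<pi>] that by blast
  then show thesis
    using that \<pi> bchoice[OF f[unfolded Bex_def]] by blast
qed

lemma conj_aut_hom:
  assumes "g \<in> carrier (conj_aut_group n)"
  shows "g \<in> hom (free_group n) (free_group n)"
  using assms by (simp add: conj_aut_group_def auto_def)

text \<open>
  A conjugate of a conjugate is a conjugate: if g sends x_i to a conjugate of x_k by f, and h
  sends x_k to a conjugate by f', then the product sends x_i to a conjugate by f' h(f).
\<close>
lemma conj_aut_group_closed:
  assumes g: "g \<in> carrier (conj_aut_group n)" and h: "h \<in> carrier (conj_aut_group n)"
  shows "g \<otimes>\<^bsub>conj_aut_group n\<^esub> h \<in> carrier (conj_aut_group n)"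
proof -
  let ?F = "free_group n"
  interpret F: group ?F by (rule group_free_group)
  interpret h: group_hom ?F ?F h
    using conj_aut_hom[OF h] by unfold_locales
  obtain \<pi> f where \<pi>: "\<pi> permutes {1..n}" "\<And>i. i \<in> {1..n} \<Longrightarrow> \<pi> i \<in> {1..n}"
    and f: "\<And>i. i \<in> {1..n} \<Longrightarrow> f i \<in> carrier ?F"
    and g_gen: "\<And>i. i \<in> {1..n} \<Longrightarrow> g (gen i) = inv\<^bsub>?F\<^esub> f i \<otimes>\<^bsub>?F\<^esub> gen (\<pi> i) \<otimes>\<^bsub>?F\<^esub> f i"
    by (rule conj_aut_groupE[OF g]) blast
  obtain \<pi>' f' where \<pi>': "\<pi>' permutes {1..n}" "\<And>i. i \<in> {1..n} \<Longrightarrow> \<pi>' i \<in> {1..n}"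
    and f': "\<And>i. i \<in> {1..n} \<Longrightarrow> f' i \<in> carrier ?F"
    and h_gen: "\<And>i. i \<in> {1..n} \<Longrightarrow> h (gen i) = inv\<^bsub>?F\<^esub> f' i \<otimes>\<^bsub>?F\<^esub> gen (\<pi>' i) \<otimes>\<^bsub>?F\<^esub> f' i"
    by (rule conj_aut_groupE[OF h]) blast
  have "compose (carrier ?F) h g \<in> carrier (conj_aut_group n)"
  proof (rule conj_aut_groupI)
    have "compose (carrier ?F) h g \<in> Bij (carrier ?F)"
      using g h by (intro compose_Bij) (auto simp: conj_aut_group_def auto_def)
    moreover have "compose (carrier ?F) h g \<in> hom ?F ?F"
      using hom_in_carrier[OF conj_aut_hom[OF g]] conj_aut_hom[OF g] hom_mult[OF conj_aut_hom[OF g]]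
      by (intro homI) (simp_all add: compose_eq)
    ultimately show "compose (carrier ?F) h g \<in> auto ?F"
      by (simp add: auto_def)
    show "\<pi>' \<circ> \<pi> permutes {1..n}"
      by (rule permutes_compose[OF \<pi>(1) \<pi>'(1)])
    fix i assume i: "i \<in> {1..n}"
    show "f' (\<pi> i) \<otimes>\<^bsub>?F\<^esub> h (f i) \<in> carrier ?F"
      using f[OF i] f'[OF \<pi>(2)[OF i]] by simp
    show "compose (carrier ?F) h g (gen i) = inv\<^bsub>?F\<^esub> (f' (\<pi> i) \<otimes>\<^bsub>?F\<^esub> h (f i))
        \<otimes>\<^bsub>?F\<^esub> gen ((\<pi>' \<circ> \<pi>) i) \<otimes>\<^bsub>?F\<^esub> (f' (\<pi> i) \<otimes>\<^bsub>?F\<^esub> h (f i))"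
      using f[OF i] f'[OF \<pi>(2)[OF i]] gen_in_free_group[OF i] gen_in_free_group[OF \<pi>(2)[OF i]]
        gen_in_free_group[OF \<pi>'(2)[OF \<pi>(2)[OF i]]]
      by (simp add: compose_eq g_gen[OF i] h_gen[OF \<pi>(2)[OF i]] F.inv_mult_group F.m_assoc)
  qed
  then show ?thesis by (simp only: mult_conj_aut_group)
qed

text \<open>
  Conjugation by a permutation that sends the pair (1, 2) to (2, 3) turns sigma_1 into sigma_2.
  As the third index is moved across the pair, this relation compares the two formulas for the
  action of sigma on a vector sharing one index with the pair, of which only one involves t.
\<close>
lemma alpha_alpha_sigma:
  assumes "n \<ge> 3"
  shows "alpha n 1 \<otimes>\<^bsub>conj_aut_group n\<^esub> alpha n 2 \<otimes>\<^bsub>conj_aut_group n\<^esub> sigma n 1 =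
         sigma n 2 \<otimes>\<^bsub>conj_aut_group n\<^esub> alpha n 1 \<otimes>\<^bsub>conj_aut_group n\<^esub> alpha n 2"
proof -
  let ?F = "free_group n"
  have i: "1 \<in> {1..<n}" "2 \<in> {1..<n}" using assms by auto
  interpret F: group ?F by (rule group_free_group)
  interpret a1: group_hom ?F ?F "alpha n (Suc 0)"
    using alpha_hom[OF i(1)] by unfold_locales simp
  interpret a2: group_hom ?F ?F "alpha n (Suc (Suc 0))"
    using alpha_hom[OF i(2)] by unfold_locales (simp add: numeral_eq_Suc)
  have "sigma n 1 (alpha n 2 (alpha n 1 w)) = alpha n 2 (alpha n 1 (sigma n 2 w))"
    if w: "w \<in> carrier ?F" for w
  proof -
    have "(sigma n 1 \<circ> (alpha n 2 \<circ> alpha n 1)) w = (alpha n 2 \<circ> (alpha n 1 \<circ> sigma n 2)) w"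
    proof (rule hom_free_group_eqI[OF group_free_group _ _ _ w])
      show "sigma n 1 \<circ> (alpha n 2 \<circ> alpha n 1) \<in> hom ?F ?F"
        by (rule hom_compose[OF hom_compose[OF alpha_hom alpha_hom] sigma_hom]) (rule i)+
      show "alpha n 2 \<circ> (alpha n 1 \<circ> sigma n 2) \<in> hom ?F ?F"
        by (rule hom_compose[OF hom_compose[OF sigma_hom alpha_hom] alpha_hom]) (rule i)+
      fix k assume k: "k \<in> {1..n}"
      have g: "gen (Suc 0) \<in> carrier ?F" "gen (Suc (Suc 0)) \<in> carrier ?F"
        "gen (Suc (Suc (Suc 0))) \<in> carrier ?F"
        using assms by auto
      have "k = 1 \<or> k = 2 \<or> k = 3 \<or> k > 3" using k by auto
      then show "(sigma n 1 \<circ> (alpha n 2 \<circ> alpha n 1)) (gen k)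
          = (alpha n 2 \<circ> (alpha n 1 \<circ> sigma n 2)) (gen k)"
        using k i assms g by (elim disjE) (simp_all add: sigma_gen alpha_gen numeral_eq_Suc)
    qed
    then show ?thesis by simp
  qed
  then show ?thesis
    using a1.hom_closed a2.hom_closed
    by (auto simp: mult_conj_aut_group compose_def fun_eq_iff intro!: restrict_ext)
qed

section \<open>Fox derivatives and the Burau matrix\<close>

text \<open>
  The shape of the derivatives of a product whose first factor is a generator or its inverse.
\<close>
lemma sum_delta_combine:
  fixes a b :: "'r::comm_ring_1"
  assumes "finite A" "i \<in> A"
  shows "(\<Sum>k\<in>A. (a * of_bool (k = i) + b * F k) * d k) = a * d i + b * (\<Sum>k\<in>A. F k * d k)"
proof -
  have delta: "(\<Sum>k\<in>A. of_bool (k = i) * d k) = d i"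
    using assms by (simp add: of_bool_def if_distrib[of "\<lambda>x. x * _"] cong: if_cong)
  have "(\<Sum>k\<in>A. (a * of_bool (k = i) + b * F k) * d k)
      = (\<Sum>k\<in>A. a * (of_bool (k = i) * d k) + b * (F k * d k))"
    by (simp add: algebra_simps)
  also have "\<dots> = a * d i + b * (\<Sum>k\<in>A. F k * d k)"
    by (simp only: sum.distrib sum_distrib_left[symmetric] delta)
  finally show ?thesis .
qed

text \<open>
  The generators of the free group are evaluated at a unit q of a commutative ring; \<open>qi\<close> is
  its inverse.
\<close>
locale burau_parameter =
  fixes q qi :: "'r::comm_ring_1"
  assumes q_qi: "q * qi = 1"
begin

lemma qi_q: "qi * q = 1"
  using q_qi by (simp add: mult.commute)

text \<open>
  The value of a word under x_i \<open>\<mapsto>\<close> q, that is, q to the power of its exponent sum.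
\<close>
definition weight :: "letter list \<Rightarrow> 'r" where
  "weight w = foldr (\<lambda>(i, e) c. (if e then q else qi) * c) w 1"

text \<open>
  The free group acts by affine maps: the generator x_i sends y to e_i + q y, its inverse letter
  by the inverse map. The linear part of the action of a word is its \<open>weight\<close>, and the
  translation part is the vector of its Fox derivatives, with every generator evaluated at q.
\<close>
definition affine :: "letter \<Rightarrow> (nat \<Rightarrow> 'r) \<Rightarrow> nat \<Rightarrow> 'r" where
  "affine = (\<lambda>(i, e) y j.
     if e then of_bool (j = i) + q * y j else qi * (y j - of_bool (j = i)))"

definition fox :: "letter list \<Rightarrow> nat \<Rightarrow> 'r" where
  "fox w = foldr affine w (\<lambda>_. 0)"

lemma foldr_affine: "foldr affine w y j = fox w j + weight w * y j"
proof (induction w)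
  case (Cons a w)
  then show ?case
    by (cases a) (simp add: fox_def weight_def affine_def algebra_simps)
qed (simp add: fox_def weight_def)

lemma weight_mult: "weight (u \<otimes>\<^bsub>free_group n\<^esub> v) = weight u * weight v"
proof -
  let ?h = "\<lambda>(i, e) c. (if e then q else qi) * c :: 'r"
  have "weight (u \<otimes>\<^bsub>free_group n\<^esub> v) = foldr ?h u (weight v)"
    unfolding weight_def mult_free_group
    by (rule foldr_push_letter_action[where A = UNIV and X = UNIV])
       (auto simp: inverse_letters_def mult.assoc[symmetric] q_qi qi_q)
  also have "foldr ?h u c = weight u * c" for c
    by (induction u) (auto simp: weight_def mult.assoc)
  finally show ?thesis .
qed

lemma fox_mult: "fox (u \<otimes>\<^bsub>free_group n\<^esub> v) j = fox u j + weight u * fox v j"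
proof -
  have "fox (u \<otimes>\<^bsub>free_group n\<^esub> v) = foldr affine u (fox v)"
    unfolding fox_def mult_free_group
    by (rule foldr_push_letter_action[where A = UNIV and X = UNIV])
       (auto simp: inverse_letters_def affine_def fun_eq_iff mult.assoc[symmetric] q_qi qi_q)
  then show ?thesis by (simp add: foldr_affine)
qed

lemma weight_one [simp]: "weight \<one>\<^bsub>free_group n\<^esub> = 1"
  by (simp add: weight_def one_free_group)

lemma fox_one [simp]: "fox \<one>\<^bsub>free_group n\<^esub> j = 0"
  by (simp add: fox_def one_free_group)

lemma weight_gen [simp]: "weight (gen i) = q"
  by (simp add: weight_def gen_def)

lemma fox_gen [simp]: "fox (gen i) j = of_bool (j = i)"
  by (simp add: fox_def gen_def affine_def)

lemma weight_inv:
  assumes "u \<in> carrier (free_group n)"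
  shows "weight (inv\<^bsub>free_group n\<^esub> u) * weight u = 1"
  using weight_mult[where u = "inv\<^bsub>free_group n\<^esub> u" and v = u and n = n] group.l_inv[OF group_free_group assms]
  by simp

lemma fox_inv:
  assumes "u \<in> carrier (free_group n)"
  shows "fox (inv\<^bsub>free_group n\<^esub> u) j = - weight (inv\<^bsub>free_group n\<^esub> u) * fox u j"
  using fox_mult[where u = "inv\<^bsub>free_group n\<^esub> u" and v = u and n = n and j = j] group.l_inv[OF group_free_group assms]
  by (simp add: add_eq_0_iff)

lemma weight_inv_gen: "i \<in> {1..n} \<Longrightarrow> weight (inv\<^bsub>free_group n\<^esub> gen i) = qi"
  by (simp add: inv_gen weight_def)

lemma weight_conjugate:
  assumes "f \<in> carrier (free_group n)"
  shows "weight (inv\<^bsub>free_group n\<^esub> f \<otimes>\<^bsub>free_group n\<^esub> x \<otimes>\<^bsub>free_group n\<^esub> f) = weight x"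
proof -
  have "weight (inv\<^bsub>free_group n\<^esub> f \<otimes>\<^bsub>free_group n\<^esub> x \<otimes>\<^bsub>free_group n\<^esub> f)
      = weight (inv\<^bsub>free_group n\<^esub> f) * weight f * weight x"
    by (simp add: weight_mult algebra_simps)
  then show ?thesis by (simp add: weight_inv[OF assms])
qed

text \<open>
  The fundamental formula of Fox calculus, after all generators have been set to q: both sides
  are derivations that take the value q - 1 on the generators.
\<close>
lemma fundamental_formula:
  assumes "w \<in> carrier (free_group n)"
  shows "(q - 1) * (\<Sum>j\<in>{1..n}. fox w j) = weight w - 1"
  using assms
proof (induction w rule: free_group_induct)
  case one
  then show ?case by simp
next
  case (gen i u)
  let ?S = "\<Sum>j\<in>{1..n}. fox u j"
  have "(\<Sum>j\<in>{1..n}. fox (gen i \<otimes>\<^bsub>free_group n\<^esub> u) j) = 1 + q * ?S"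
    using sum_delta_combine[of "{1..n}" i 1 q "fox u" "\<lambda>_. 1"] gen(1) by (simp add: fox_mult)
  then have "(q - 1) * (\<Sum>j\<in>{1..n}. fox (gen i \<otimes>\<^bsub>free_group n\<^esub> u) j) = (q - 1) * (1 + q * ?S)"
    by (simp only:)
  also have "\<dots> = q - 1 + q * ((q - 1) * ?S)"
    by (simp add: algebra_simps)
  also have "\<dots> = weight (gen i \<otimes>\<^bsub>free_group n\<^esub> u) - 1"
    unfolding gen(3) by (simp add: weight_mult algebra_simps)
  finally show ?case .
next
  case (inv_gen i u)
  let ?v = "inv\<^bsub>free_group n\<^esub> gen i \<otimes>\<^bsub>free_group n\<^esub> u" and ?S = "\<Sum>j\<in>{1..n}. fox u j"
  have "(\<Sum>j\<in>{1..n}. fox ?v j) = - qi + qi * ?S"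
    using sum_delta_combine[of "{1..n}" i "- qi" qi "fox u" "\<lambda>_. 1"] inv_gen(1)
    by (simp add: fox_mult fox_inv weight_inv_gen)
  then have "(q - 1) * (\<Sum>j\<in>{1..n}. fox ?v j) = (q - 1) * (- qi + qi * ?S)"
    by (simp only:)
  also have "\<dots> = qi - q * qi + qi * ((q - 1) * ?S)"
    by (simp add: algebra_simps)
  also have "\<dots> = weight ?v - 1"
    unfolding inv_gen(3) q_qi using inv_gen(1)
    by (simp add: weight_mult weight_inv_gen algebra_simps)
  finally show ?case .
qed

text \<open>
  The chain rule for Fox derivatives. In general the derivatives of w are to be evaluated at the
  images of the generators; here these have weight q, so the evaluation is the same on both sides.
\<close>
lemma chain_rule:
  assumes g: "g \<in> hom (free_group n) (free_group n)"
    and w: "w \<in> carrier (free_group n)"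
    and weight: "\<And>i. i \<in> {1..n} \<Longrightarrow> weight (g (gen i)) = q"
  shows "weight (g w) = weight w"
    and "fox (g w) j = (\<Sum>k\<in>{1..n}. fox w k * fox (g (gen k)) j)"
proof -
  interpret g: group_hom "free_group n" "free_group n" g
    using g group_free_group by (simp add: group_hom_def group_hom_axioms_def)
  have weight_inv': "weight (inv\<^bsub>free_group n\<^esub> (g (gen i))) = qi" if i: "i \<in> {1..n}" for i
  proof -
    have "weight (inv\<^bsub>free_group n\<^esub> (g (gen i))) * q = 1"
      using weight_inv[of "g (gen i)" n] i weight[OF i] by simp
    then have "weight (inv\<^bsub>free_group n\<^esub> (g (gen i))) * (q * qi) = qi"
      by (simp flip: mult.assoc)
    then show ?thesis by (simp add: q_qi)
  qed
  have "weight (g w) = weight w \<and>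
      fox (g w) j = (\<Sum>k\<in>{1..n}. fox w k * fox (g (gen k)) j)"
    using w
  proof (induction w rule: free_group_induct)
    case one
    then show ?case by simp
  next
    case (gen i u)
    then show ?case
      using sum_delta_combine[of "{1..n}" i 1 q "fox u" "\<lambda>k. fox (g (gen k)) j"]
      by (simp add: weight_mult fox_mult weight)
  next
    case (inv_gen i u)
    then show ?case
      using sum_delta_combine[of "{1..n}" i "- qi" qi "fox u" "\<lambda>k. fox (g (gen k)) j"]
      by (simp add: weight_mult fox_mult fox_inv weight_inv' weight_inv_gen)
  qed
  then show "weight (g w) = weight w"
    and "fox (g w) j = (\<Sum>k\<in>{1..n}. fox w k * fox (g (gen k)) j)" by auto
qed

definition burau :: "(letter list \<Rightarrow> letter list) \<Rightarrow> nat \<Rightarrow> nat \<Rightarrow> 'r" where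
  "burau g i = fox (g (gen i))"

lemma conj_aut_weight_gen:
  assumes "g \<in> carrier (conj_aut_group n)" "i \<in> {1..n}"
  shows "weight (g (gen i)) = q"
  by (rule conj_aut_groupE[OF assms(1)]) (simp only: assms(2) weight_conjugate weight_gen)

text \<open>
  The conjugate of x_k by f has as sum of its derivatives
  W (1 + (q - 1) S), where W is the weight of the inverse of f and S is the sum of the
  derivatives of f. By the fundamental formula the bracket is the weight of f.
\<close>
lemma burau_row_sum:
  assumes "g \<in> carrier (conj_aut_group n)" "i \<in> {1..n}"
  shows "(\<Sum>j\<in>{1..n}. burau g i j) = 1"
proof -
  obtain k f where 1: "k \<in> {1..n}" "f \<in> carrier (free_group n)"
    "g (gen i) = inv\<^bsub>free_group n\<^esub> f \<otimes>\<^bsub>free_group n\<^esub> gen k \<otimes>\<^bsub>free_group n\<^esub> f"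
    using assms(2) conj_aut_groupE[OF assms(1)] by metis
  define W where "W = weight (inv\<^bsub>free_group n\<^esub> f)"
  have "burau g i j = (W * of_bool (j = k) + (W * q - W) * fox f j) * 1" for j
    using 1 by (simp add: burau_def fox_mult weight_mult fox_inv W_def algebra_simps)
  then have "(\<Sum>j\<in>{1..n}. burau g i j) = W * 1 + (W * q - W) * (\<Sum>j\<in>{1..n}. fox f j * 1)"
    using 1(1) by (simp only: sum_delta_combine finite_atLeastAtMost)
  also have "\<dots> = W * (1 + (q - 1) * (\<Sum>j\<in>{1..n}. fox f j))"
    by (simp add: algebra_simps)
  also have "\<dots> = 1"
    using 1(2) by (simp only: fundamental_formula W_def) (simp add: weight_inv)
  finally show ?thesis .
qed

lemma burau_compose:
  assumes "g \<in> hom (free_group n) (free_group n)" "h \<in> hom (free_group n) (free_group n)"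
    and "\<And>i. i \<in> {1..n} \<Longrightarrow> weight (h (gen i)) = q" and i: "i \<in> {1..n}"
  shows "burau (compose (carrier (free_group n)) h g) i j
    = (\<Sum>k\<in>{1..n}. burau g i k * burau h k j)"
  using chain_rule(2)[OF assms(2) _ assms(3), of "g (gen i)"] assms(1) i
  by (simp add: burau_def compose_eq hom_def Pi_def)

lemma burau_identity: "burau (\<lambda>w\<in>carrier (free_group n). w) i j = of_bool (j = i)" if "i \<in> {1..n}"
  using that gen_in_free_group[OF that] by (simp add: burau_def)

text \<open>
  The inverse matrix is the Burau matrix of the inverse automorphism. The chain rule applies to
  that automorphism because it preserves weights, being inverse to a weight-preserving map.
\<close>
lemma burau_inverse:
  assumes g: "g \<in> carrier (conj_aut_group n)"
  obtains B where "\<And>i j. i \<in> {1..n} \<Longrightarrow> j \<in> {1..n} \<Longrightarrow>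
      (\<Sum>k\<in>{1..n}. burau g i k * B k j) = of_bool (j = i)"
    and "\<And>i j. i \<in> {1..n} \<Longrightarrow> j \<in> {1..n} \<Longrightarrow>
      (\<Sum>k\<in>{1..n}. B i k * burau g k j) = of_bool (j = i)"
proof -
  let ?F = "free_group n" and ?C = "carrier (free_group n)"
  interpret F: group ?F by (rule group_free_group)
  have hom: "g \<in> hom ?F ?F" and bij: "bij_betw g ?C ?C"
    using g by (auto simp: conj_aut_group_def auto_def Bij_def)
  define h where "h = restrict (inv_into ?C g) ?C"
  have h: "h \<in> hom ?F ?F"
    using F.iso_set_sym[of g ?F] hom bij F.group_axioms
    by (auto simp: iso_def h_def hom_def)
  have gh: "g (h w) = w" and hg: "h (g w) = w" if "w \<in> ?C" for w
    using that bij by (auto simp: h_def bij_betw_inv_into_right bij_betw_inv_into_left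
        dest: bij_betwE)
  have weight_g: "weight (g (gen i)) = q" if "i \<in> {1..n}" for i
    using conj_aut_weight_gen[OF g that] .
  have weight_h: "weight (h (gen i)) = q" if i: "i \<in> {1..n}" for i
    using chain_rule(1)[OF hom _ weight_g, of "h (gen i)"] h i by (simp add: gh hom_def Pi_def)
  have "compose ?C h g = (\<lambda>w\<in>?C. w)" "compose ?C g h = (\<lambda>w\<in>?C. w)"
    using gh hg by (auto simp: compose_def)
  then show thesis
    using that[of "burau h"] burau_compose[OF hom h weight_h, symmetric]
      burau_compose[OF h hom weight_g, symmetric] burau_identity
    by presburger
qed

end

section \<open>The quadratic action of matrices with row sums one\<close>

lemma finite_basis_index [simp]: "finite (basis_index n)"
  by (rule finite_subset[of _ "{1..n} \<times> {1..n}"]) (auto simp: basis_index_def)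

text \<open>
  The coordinates of \<open>w \<otimes> w\<close> above the diagonal, with the sign that makes the square of
  e_k - e_l the basis vector v_kl. A symmetric matrix with row sums zero, such as
  \<open>w \<otimes> w\<close> for w of coordinate sum zero, is determined by these entries, so V_n is a model
  of the module of such matrices.
\<close>
definition square :: "nat \<Rightarrow> (nat \<Rightarrow> 'r::comm_ring_1) \<Rightarrow> nat \<times> nat \<Rightarrow> 'r" where
  "square n w = (\<lambda>(c, d). if (c, d) \<in> basis_index n then - (w c * w d) else 0)"

lemma square_unit_diff:
  assumes "(k, l) \<in> basis_index n"
  shows "square n (\<lambda>j. of_bool (j = k) - of_bool (j = l)) = basis_vec k l"
  using assms by (fastforce simp: square_def basis_vec_def basis_index_def)

lemma square_minus_commute:
  "square n (\<lambda>j. u j - v j) = square n (\<lambda>j. v j - u j)"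
  by (auto simp: square_def fun_eq_iff algebra_simps)

lemma square_scale: "square n (\<lambda>j. p * u j) b = p\<^sup>2 * square n u b"
  by (cases b) (simp add: square_def power2_eq_square algebra_simps)

text \<open>
  The polarization that produces the three terms in the formula for sigma_i: for v_ki, the vectors u and v are e_k - e_i and e_k - e_{i+1}, and p = 1 - q.
\<close>
lemma square_affine:
  "square n (\<lambda>j. p * u j + (1 - p) * v j) b
    = p * square n u b + (1 - p) * square n v b - p * (1 - p) * square n (\<lambda>j. u j - v j) b"
  by (cases b) (simp add: square_def algebra_simps)

lemma sum_square_eq_sum_basis_index:
  fixes f :: "nat \<Rightarrow> nat \<Rightarrow> 'r::comm_ring_1"
  shows "(\<Sum>a\<in>{1..n}. \<Sum>b\<in>{1..n}. f a b)
    = (\<Sum>(a, b)\<in>basis_index n. f a b + f b a) + (\<Sum>a\<in>{1..n}. f a a)"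
proof -
  let ?g = "\<lambda>(a, b). f a b"
  let ?lower = "prod.swap ` basis_index n" and ?diag = "(\<lambda>a. (a, a)) ` {1..n}"
  have "{1..n} \<times> {1..n} = (basis_index n \<union> ?lower) \<union> ?diag"
  proof (rule Set.set_eqI)
    fix ab :: "nat \<times> nat"
    obtain a b where ab: "ab = (a, b)" by (cases ab)
    show "ab \<in> {1..n} \<times> {1..n} \<longleftrightarrow> ab \<in> (basis_index n \<union> ?lower) \<union> ?diag"
      by (cases a b rule: linorder_cases) (auto simp: ab basis_index_def image_iff)
  qed
  then have "(\<Sum>a\<in>{1..n}. \<Sum>b\<in>{1..n}. f a b) = sum ?g ((basis_index n \<union> ?lower) \<union> ?diag)"
    by (simp add: sum.cartesian_product)
  also have "\<dots> = sum ?g (basis_index n) + sum ?g ?lower + sum ?g ?diag"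
  proof -
    have "basis_index n \<inter> ?lower = {}" "(basis_index n \<union> ?lower) \<inter> ?diag = {}"
      by (auto simp: basis_index_def)
    then show ?thesis
      by (simp add: sum.union_disjoint)
  qed
  also have "sum ?g ?lower = (\<Sum>(a, b)\<in>basis_index n. f b a)"
    by (subst sum.reindex) (auto simp: inj_on_def intro!: sum.cong)
  also have "sum ?g ?diag = (\<Sum>a\<in>{1..n}. f a a)"
    by (subst sum.reindex) (auto simp: inj_on_def)
  finally show ?thesis
    by (simp add: sum.distrib split_beta)
qed

text \<open>
  Since w has coordinate sum zero, \<open>w \<otimes> w\<close> is the combination of the squares of the
  e_a - e_b with coefficients -w_a w_b. Applying a matrix A to both sides gives this identity; it
  is what makes the action on squares multiplicative.
\<close>
lemma square_substitute:
  fixes A :: "nat \<Rightarrow> nat \<Rightarrow> 'r::comm_ring_1"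
  assumes w: "(\<Sum>a\<in>{1..n}. w a) = 0"
  shows "(\<Sum>(a, b)\<in>basis_index n. square n w (a, b) * square n (\<lambda>j. A a j - A b j) x)
    = square n (\<lambda>j. \<Sum>a\<in>{1..n}. w a * A a j) x"
proof (cases x)
  case (Pair c d)
  \<comment> \<open>\<open>f a b + f b a\<close> is minus the product of the differences. Summed over all pairs, the
    second term of f vanishes because the w_b add up to zero.\<close>
  define f where "f = (\<lambda>a b. w a * w b * (A a c * A b d - A a c * A a d))"
  have "(\<Sum>(a, b)\<in>basis_index n. w a * w b * ((A a c - A b c) * (A a d - A b d)))
      = - (\<Sum>(a, b)\<in>basis_index n. f a b + f b a)"
    unfolding sum_negf[symmetric]
    by (intro sum.cong) (auto simp: f_def algebra_simps)
  also have "\<dots> = - (\<Sum>a\<in>{1..n}. \<Sum>b\<in>{1..n}. f a b)"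
    unfolding sum_square_eq_sum_basis_index by (simp add: f_def)
  also have "(\<Sum>a\<in>{1..n}. \<Sum>b\<in>{1..n}. f a b)
      = (\<Sum>a\<in>{1..n}. \<Sum>b\<in>{1..n}. (w a * A a c) * (w b * A b d))
        - (\<Sum>a\<in>{1..n}. \<Sum>b\<in>{1..n}. (w a * A a c * A a d) * w b)"
    unfolding sum_subtractf[symmetric]
    by (intro sum.cong) (auto simp: f_def algebra_simps)
  also have "\<dots> = (\<Sum>a\<in>{1..n}. w a * A a c) * (\<Sum>b\<in>{1..n}. w b * A b d)"
    by (simp only: sum_product[symmetric] w) simp
  finally have sum: "(\<Sum>(a, b)\<in>basis_index n. w a * w b * ((A a c - A b c) * (A a d - A b d)))
      = - ((\<Sum>a\<in>{1..n}. w a * A a c) * (\<Sum>b\<in>{1..n}. w b * A b d))" .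
  show ?thesis
  proof (cases "(c, d) \<in> basis_index n")
    case True
    have "(\<Sum>(a, b)\<in>basis_index n. square n w (a, b) * square n (\<lambda>j. A a j - A b j) x)
      = (\<Sum>(a, b)\<in>basis_index n. w a * w b * ((A a c - A b c) * (A a d - A b d)))"
      using True Pair by (intro sum.cong) (auto simp: square_def)
    then show ?thesis
      using True Pair sum by (simp add: square_def)
  next
    case False
    then show ?thesis
      using Pair by (auto simp: square_def intro!: sum.neutral)
  qed
qed

lemma linear_ext_cong:
  assumes "\<And>k l. (k, l) \<in> basis_index n \<Longrightarrow> m k l = m' k l"
  shows "linear_ext n m = linear_ext n m'"
proof -
  have "(\<Sum>(k, l)\<in>basis_index n. x (k, l) * m k l b) = (\<Sum>(k, l)\<in>basis_index n. x (k, l) * m' k l b)"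
    for x b
    using assms by (intro sum.cong) auto
  then show ?thesis by (simp add: linear_ext_def)
qed

lemma basis_vec_in_V: "(k, l) \<in> basis_index n \<Longrightarrow> basis_vec k l \<in> V n"
  by (auto simp: V_def basis_vec_def)

lemma linear_ext_basis:
  fixes m :: "nat \<Rightarrow> nat \<Rightarrow> nat \<times> nat \<Rightarrow> 'r::comm_ring_1"
  assumes "(k, l) \<in> basis_index n"
  shows "linear_ext n m (basis_vec k l) = m k l"
proof -
  have "(\<Sum>(k', l')\<in>basis_index n. basis_vec k l (k', l') * m k' l' b)
      = (\<Sum>y\<in>basis_index n. if y = (k, l) then m k l b else 0)" for b
    by (intro sum.cong) (auto simp: basis_vec_def split: if_splits)
  then show ?thesis
    using assms by (simp add: linear_ext_def basis_vec_in_V fun_eq_iff)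
qed

lemma linear_ext_coordinate:
  assumes "x \<in> V n" "b \<in> basis_index n"
    and "\<And>k l. (k, l) \<in> basis_index n \<Longrightarrow> m k l c = of_bool ((k, l) = b)"
  shows "linear_ext n m x c = x b"
proof -
  have "(\<Sum>(k, l)\<in>basis_index n. x (k, l) * m k l c)
      = (\<Sum>y\<in>basis_index n. if y = b then x b else 0)"
    using assms(3) by (intro sum.cong) auto
  then show ?thesis
    using assms(1,2) by (simp add: linear_ext_def)
qed

lemma linear_ext_basis_vec:
  "linear_ext n basis_vec = (\<lambda>x\<in>V n. x :: nat \<times> nat \<Rightarrow> 'r::comm_ring_1)"
proof -
  have "(\<Sum>(k, l)\<in>basis_index n. x (k, l) * basis_vec k l b) = x b" if "x \<in> V n" for x :: "nat \<times> nat \<Rightarrow> 'r" and b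
  proof -
    have "(\<Sum>(k, l)\<in>basis_index n. x (k, l) * basis_vec k l b)
        = (\<Sum>y\<in>basis_index n. if y = b then x b else 0)"
      by (intro sum.cong) (auto simp: basis_vec_def)
    then show ?thesis
      using that by (cases b) (simp add: V_def)
  qed
  then show ?thesis by (auto simp: linear_ext_def fun_eq_iff)
qed

text \<open>
  With v_kl read as the square of e_k - e_l, this is the substitution of the rows of A for the
  unit vectors.
\<close>
definition quadratic_action :: "nat \<Rightarrow> (nat \<Rightarrow> nat \<Rightarrow> 'r::comm_ring_1)
    \<Rightarrow> (nat \<times> nat \<Rightarrow> 'r) \<Rightarrow> nat \<times> nat \<Rightarrow> 'r" where
  "quadratic_action n A = linear_ext n (\<lambda>k l. square n (\<lambda>j. A k j - A l j))"

lemma quadratic_action_in_V: "x \<in> V n \<Longrightarrow> quadratic_action n A x \<in> V n"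
  by (auto simp: quadratic_action_def linear_ext_def V_def square_def intro!: sum.neutral)

lemma quadratic_action_cong:
  assumes "\<And>i j. i \<in> {1..n} \<Longrightarrow> j \<in> {1..n} \<Longrightarrow> A i j = B i j"
  shows "quadratic_action n A = quadratic_action n B"
  unfolding quadratic_action_def using assms
  by (intro linear_ext_cong) (auto simp: square_def basis_index_def fun_eq_iff)

lemma quadratic_action_identity:
  "quadratic_action n (\<lambda>i j. of_bool (j = i)) = (\<lambda>x\<in>V n. x)"
  unfolding quadratic_action_def
  by (subst linear_ext_basis_vec[symmetric]) (intro linear_ext_cong square_unit_diff)

text \<open>
  Row sums one are used through differences of rows of A: these have coordinate sum zero, so that
  \<open>square_substitute\<close> applies to them.
\<close>
lemma quadratic_action_compose:
  assumes A: "\<And>i. i \<in> {1..n} \<Longrightarrow> (\<Sum>j\<in>{1..n}. A i j) = 1"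
  shows "compose (V n) (quadratic_action n B) (quadratic_action n A)
    = quadratic_action n (\<lambda>i j. \<Sum>k\<in>{1..n}. A i k * B k j)"
proof -
  have "quadratic_action n B (quadratic_action n A x) b
      = quadratic_action n (\<lambda>i j. \<Sum>k\<in>{1..n}. A i k * B k j) x b" if x: "x \<in> V n" for x b
  proof -
    have "quadratic_action n B (quadratic_action n A x) b
        = (\<Sum>(c, d)\<in>basis_index n. (\<Sum>(k, l)\<in>basis_index n.
            x (k, l) * square n (\<lambda>j. A k j - A l j) (c, d)) * square n (\<lambda>j. B c j - B d j) b)"
      using x quadratic_action_in_V[OF x, of A] unfolding quadratic_action_def linear_ext_def by simp
    also have "\<dots> = (\<Sum>(k, l)\<in>basis_index n. x (k, l) * (\<Sum>(c, d)\<in>basis_index n.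
            square n (\<lambda>j. A k j - A l j) (c, d) * square n (\<lambda>j. B c j - B d j) b))"
      by (simp add: split_beta sum_distrib_left sum_distrib_right mult.assoc)
         (rule sum.swap)
    also have "\<dots> = (\<Sum>(k, l)\<in>basis_index n. x (k, l) *
        square n (\<lambda>j. \<Sum>a\<in>{1..n}. (A k a - A l a) * B a j) b)"
    proof (intro sum.cong refl)
      fix y assume "y \<in> basis_index n"
      then obtain k l where y: "y = (k, l)" "k \<in> {1..n}" "l \<in> {1..n}"
        by (auto simp: basis_index_def)
      have "(\<Sum>a\<in>{1..n}. A k a - A l a) = 0"
        by (simp only: sum_subtractf A y) simp
      from square_substitute[OF this] show "(case y of (k, l) \<Rightarrow> x (k, l) * (\<Sum>(c, d)\<in>basis_index n.
            square n (\<lambda>j. A k j - A l j) (c, d) * square n (\<lambda>j. B c j - B d j) b))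
        = (case y of (k, l) \<Rightarrow> x (k, l) * square n (\<lambda>j. \<Sum>a\<in>{1..n}. (A k a - A l a) * B a j) b)"
        by (simp add: y)
    qed
    also have "\<dots> = quadratic_action n (\<lambda>i j. \<Sum>k\<in>{1..n}. A i k * B k j) x b"
      using x by (simp add: quadratic_action_def linear_ext_def left_diff_distrib sum_subtractf)
    finally show ?thesis .
  qed
  moreover have "quadratic_action n C x = undefined" if "x \<notin> V n" for C and x :: "nat \<times> nat \<Rightarrow> 'a"
    using that by (simp add: quadratic_action_def linear_ext_def)
  ultimately show ?thesis
    by (auto simp: compose_def fun_eq_iff)
qed

lemma quadratic_action_in_GL:
  assumes A: "\<And>i. i \<in> {1..n} \<Longrightarrow> (\<Sum>j\<in>{1..n}. A i j) = 1"
    and AB: "\<And>i j. i \<in> {1..n} \<Longrightarrow> j \<in> {1..n} \<Longrightarrow> (\<Sum>k\<in>{1..n}. A i k * B k j) = of_bool (j = i)"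
    and BA: "\<And>i j. i \<in> {1..n} \<Longrightarrow> j \<in> {1..n} \<Longrightarrow> (\<Sum>k\<in>{1..n}. B i k * A k j) = of_bool (j = i)"
  shows "quadratic_action n A \<in> carrier (GL n)"
proof -
  have B: "(\<Sum>j\<in>{1..n}. B i j) = 1" if i: "i \<in> {1..n}" for i
  proof -
    have "(\<Sum>j\<in>{1..n}. B i j) = (\<Sum>k\<in>{1..n}. B i k * (\<Sum>j\<in>{1..n}. A k j))"
      using A by (intro sum.cong) auto
    also have "\<dots> = (\<Sum>j\<in>{1..n}. \<Sum>k\<in>{1..n}. B i k * A k j)"
      by (simp only: sum_distrib_left) (rule sum.swap)
    also have "\<dots> = (\<Sum>j\<in>{1..n}. of_bool (j = i))"
      using BA[OF i] by (intro sum.cong) auto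
    also have "\<dots> = 1"
      using sum_delta_combine[of "{1..n}" i 1 0 "\<lambda>_. 0" "\<lambda>_. 1 :: 'a"] i by simp
    finally show ?thesis .
  qed
  have inverse: "quadratic_action n D (quadratic_action n C x) = x"
    if "\<And>i. i \<in> {1..n} \<Longrightarrow> (\<Sum>j\<in>{1..n}. C i j) = 1"
      and "\<And>i j. i \<in> {1..n} \<Longrightarrow> j \<in> {1..n} \<Longrightarrow> (\<Sum>k\<in>{1..n}. C i k * D k j) = of_bool (j = i)"
      and "x \<in> V n"
    for C D :: "nat \<Rightarrow> nat \<Rightarrow> 'a" and x
  proof -
    have "compose (V n) (quadratic_action n D) (quadratic_action n C) = (\<lambda>x\<in>V n. x)"
      by (subst quadratic_action_compose[OF that(1)], assumption,
          subst quadratic_action_identity[symmetric], rule quadratic_action_cong, rule that(2))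
    then show ?thesis
      using that(3) by (metis compose_eq restrict_apply')
  qed
  have "quadratic_action n B (quadratic_action n A x) = x"
    and "quadratic_action n A (quadratic_action n B x) = x" if "x \<in> V n" for x
    using inverse[of A B x] inverse[of B A x] A B AB BA that by blast+
  then have "bij_betw (quadratic_action n A) (V n) (V n)"
    by (intro bij_betwI[where g = "quadratic_action n B"]) (auto simp: quadratic_action_in_V)
  moreover have "quadratic_action n A \<in> extensional (V n)"
    by (simp add: quadratic_action_def linear_ext_def)
  moreover have "(\<lambda>b. x b + y b) \<in> V n" "(\<lambda>b. c * x b) \<in> V n"
    if "x \<in> V n" "y \<in> V n" for x y :: "nat \<times> nat \<Rightarrow> 'a" and c
    using that by (auto simp: V_def)
  ultimately show ?thesis
    by (auto simp: GL_def Bij_def quadratic_action_def linear_ext_def fun_eq_iff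
        split_beta distrib_right sum.distrib sum_distrib_left mult.assoc)
qed

section \<open>The representation at t = 1\<close>

context burau_parameter
begin

lemma burau_sigma:
  assumes "i \<in> {1..<n}" "k \<in> {1..n}"
  shows "burau (sigma n i) k j =
    (if k = i then (1 - q) * of_bool (j = i) + q * of_bool (j = i + 1)
     else if k = i + 1 then of_bool (j = i) else of_bool (j = k))"
proof -
  have "i \<in> {1..n}" using assms by auto
  then show ?thesis
    using assms unfolding burau_def
    by (auto simp: sigma_gen fox_mult weight_mult fox_inv weight_inv_gen q_qi mult.assoc)
qed

lemma burau_alpha:
  assumes "i \<in> {1..<n}" "k \<in> {1..n}"
  shows "burau (alpha n i) k j =
    of_bool (j = (if k = i then i + 1 else if k = i + 1 then i else k))"
  using assms by (simp add: burau_def alpha_gen)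

lemma quadratic_action_burau_alpha:
  assumes i: "i \<in> {1..<n}"
  shows "quadratic_action n (burau (alpha n i)) = rho_alpha n i"
  unfolding quadratic_action_def rho_alpha_def
proof (rule linear_ext_cong)
  fix k l assume kl: "(k, l) \<in> basis_index n"
  then have kl': "k \<in> {1..n}" "l \<in> {1..n}" "k < l" by (auto simp: basis_index_def)
  have basis: "square n (\<lambda>j. of_bool (j = a) - of_bool (j = b)) = basis_vec a b"
    "square n (\<lambda>j. of_bool (j = b) - of_bool (j = a)) = basis_vec a b"
    if "1 \<le> a" "a < b" "b \<le> n" for a b
    using square_unit_diff[of a b n] that
    by (simp_all add: basis_index_def square_minus_commute[of n "\<lambda>j. of_bool (j = b)"])
  show "square n (\<lambda>j. burau (alpha n i) k j - burau (alpha n i) l j)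
    = (if l = i then basis_vec k (i + 1)
     else if k < i \<and> l = i + 1 then basis_vec k i
     else if k = i \<and> l = i + 1 then basis_vec i (i + 1)
     else if k = i then basis_vec (i + 1) l
     else if k = i + 1 then basis_vec i l
     else basis_vec k l)"
    using i kl' by (auto simp: burau_alpha basis)
qed

text \<open>
  The rows of the Burau matrix of sigma_i are unit vectors except for row i, which is
  (1 - q) e_i + q e_{i+1}. For a pair meeting {i, i + 1} in i alone the difference of rows is an
  affine combination of two differences of unit vectors, treated by \<open>square_affine\<close>; for
  the pair (i, i + 1) it is -q (e_i - e_{i+1}), whose square gives the factor q^2.
\<close>
lemma quadratic_action_burau_sigma:
  assumes i: "i \<in> {1..<n}"
  shows "quadratic_action n (burau (sigma n i)) = rho_sigma n 1 q i"
  unfolding quadratic_action_def rho_sigma_def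
proof (rule linear_ext_cong, rule ext)
  fix k l b assume kl: "(k, l) \<in> basis_index n"
  then have kl': "k \<in> {1..n}" "l \<in> {1..n}" "k < l" by (auto simp: basis_index_def)
  let ?d = "\<lambda>a c j. of_bool (j = a) - of_bool (j = c) :: 'r"
  have basis: "square n (?d a c) = basis_vec a c" "square n (?d c a) = basis_vec a c"
    if "1 \<le> a" "a < c" "c \<le> n" for a c
    using square_unit_diff[of a c n] that
    by (simp_all add: basis_index_def square_minus_commute[of n "\<lambda>j. of_bool (j = c)"])
  have split: "square n (\<lambda>j. (1 - q) * u j + q * v j) b
      = (1 - q) * square n u b + q * square n v b + q * (q - 1) * square n (\<lambda>j. u j - v j) b"
    for u v
    using square_affine[of n "1 - q" u v b] by (simp add: algebra_simps)
  let ?w = "\<lambda>j. burau (sigma n i) k j - burau (sigma n i) l j"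
  consider "l = i" | "k < i" "l = i + 1" | "k = i" "l = i + 1" | "k = i" "l > i + 1"
    | "k = i + 1" | "k \<noteq> i" "k \<noteq> i + 1" "l \<noteq> i" "l \<noteq> i + 1"
    using kl' by linarith
  then show "square n ?w b =
    (if l = i then
       (1 - q) * basis_vec k i b + q * basis_vec k (i + 1) b
         + q * (q - 1) * basis_vec i (i + 1) b
     else if k < i \<and> l = i + 1 then basis_vec k i b
     else if k = i \<and> l = i + 1 then 1 * q\<^sup>2 * basis_vec i (i + 1) b
     else if k = i then
       1 * q * (q - 1) * basis_vec i (i + 1) b + (1 - q) * basis_vec i l b
         + q * basis_vec (i + 1) l b
     else if k = i + 1 then basis_vec i l b
     else basis_vec k l b)"
  proof cases
    case 1
    have "?w = (\<lambda>j. (1 - q) * ?d k i j + q * ?d k (i + 1) j)"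
      using 1 i kl' by (auto simp: burau_sigma algebra_simps)
    then have "square n ?w b = (1 - q) * square n (?d k i) b + q * square n (?d k (i + 1)) b
        + q * (q - 1) * square n (?d (i + 1) i) b"
      by (simp only: split) (simp add: algebra_simps)
    then show ?thesis
      using 1 i kl' by (simp add: basis)
  next
    case 3
    have "?w = (\<lambda>j. q * ?d (i + 1) i j)"
      using 3 i kl' by (auto simp: burau_sigma algebra_simps)
    then have "square n ?w b = q\<^sup>2 * square n (?d (i + 1) i) b"
      by (simp only: square_scale)
    then show ?thesis
      using 3 i kl' by (simp add: basis)
  next
    case 4
    have "?w = (\<lambda>j. (1 - q) * ?d i l j + q * ?d (i + 1) l j)"
      using 4 i kl' by (auto simp: burau_sigma algebra_simps)
    then have "square n ?w b = (1 - q) * square n (?d i l) b + q * square n (?d (i + 1) l) b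
        + q * (q - 1) * square n (?d i (i + 1)) b"
      by (simp only: split) (simp add: algebra_simps)
    then show ?thesis
      using 4 i kl' by (simp add: basis)
  qed (use i kl' in \<open>auto simp: burau_sigma basis\<close>)
qed

lemma quadratic_action_burau_hom:
  "(\<lambda>g. quadratic_action n (burau g)) \<in> hom (conj_aut_group n) (GL n)"
proof (rule homI)
  fix g assume g: "g \<in> carrier (conj_aut_group n)"
  obtain B where "\<And>i j. i \<in> {1..n} \<Longrightarrow> j \<in> {1..n} \<Longrightarrow>
      (\<Sum>k\<in>{1..n}. burau g i k * B k j) = of_bool (j = i)"
    and "\<And>i j. i \<in> {1..n} \<Longrightarrow> j \<in> {1..n} \<Longrightarrow>
      (\<Sum>k\<in>{1..n}. B i k * burau g k j) = of_bool (j = i)"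
    using burau_inverse[OF g] by blast
  then show "quadratic_action n (burau g) \<in> carrier (GL n)"
    using burau_row_sum[OF g] by (rule quadratic_action_in_GL[rotated])
next
  fix g h assume gh: "g \<in> carrier (conj_aut_group n)" "h \<in> carrier (conj_aut_group n)"
  have "quadratic_action n (burau (g \<otimes>\<^bsub>conj_aut_group n\<^esub> h))
      = quadratic_action n (\<lambda>i j. \<Sum>k\<in>{1..n}. burau g i k * burau h k j)"
    unfolding mult_conj_aut_group
    by (rule quadratic_action_cong)
       (rule burau_compose[OF conj_aut_hom[OF gh(1)] conj_aut_hom[OF gh(2)] conj_aut_weight_gen[OF gh(2)]])
  also have "\<dots> = compose (V n) (quadratic_action n (burau h)) (quadratic_action n (burau g))"
    by (rule quadratic_action_compose[symmetric, OF burau_row_sum[OF gh(1)]])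
  also have "\<dots> = quadratic_action n (burau g) \<otimes>\<^bsub>GL n\<^esub> quadratic_action n (burau h)"
    by (simp add: GL_def)
  finally show "quadratic_action n (burau (g \<otimes>\<^bsub>conj_aut_group n\<^esub> h))
      = quadratic_action n (burau g) \<otimes>\<^bsub>GL n\<^esub> quadratic_action n (burau h)" .
qed

end

section \<open>The relation that forces t = 1\<close>

text \<open>
  Multiplication by q shifts the exponents, so an f fixed by it has its exponents shifted onto
  themselves; a finite nonempty set of integers has no such shift. The argument is about
  exponents alone, so zero divisors in the coefficient ring do no harm.
\<close>
lemma var_q_minus_one_cancel:
  fixes f :: "'a::comm_ring_1 laurent"
  assumes "(var_q - 1) * f = 0"
  shows "f = 0"
proof (rule ccontr)
  assume "f \<noteq> 0"
  then have ne: "Poly_Mapping.keys f \<noteq> {}" by simp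
  have "var_q * f = f"
    using assms by (simp add: algebra_simps)
  moreover have "Poly_Mapping.lookup (var_q * f) (k + 1) = Poly_Mapping.lookup f k" for k
    by (simp add: var_q_def lookup_mult lookup_single when_mult add.commute[of k])
  ultimately have shift: "Poly_Mapping.lookup f (k + 1) = Poly_Mapping.lookup f k" for k
    by simp
  define m where "m = Max (Poly_Mapping.keys f)"
  have "m \<in> Poly_Mapping.keys f"
    using ne by (simp add: m_def)
  then have "m + 1 \<in> Poly_Mapping.keys f"
    using shift[of m] by (simp add: in_keys_iff)
  then have "m + 1 \<le> m"
    unfolding m_def by (intro Max_ge) auto
  then show False by simp
qed

lemma rho_sigma_in_V: "x \<in> V n \<Longrightarrow> i \<in> {1..<n} \<Longrightarrow> rho_sigma n t q i x \<in> V n"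
  by (auto simp: rho_sigma_def linear_ext_def V_def basis_vec_def basis_index_def intro!: sum.neutral)

lemma rho_alpha_in_V: "x \<in> V n \<Longrightarrow> i \<in> {1..<n} \<Longrightarrow> rho_alpha n i x \<in> V n"
  by (auto simp: rho_alpha_def linear_ext_def V_def basis_vec_def basis_index_def intro!: sum.neutral)

text \<open>
  The permutations send v_12 to v_13, which shares its smaller index with the pair (1, 2).
\<close>
lemma alpha_alpha_sigma_coefficient:
  assumes n: "n \<ge> 3"
  shows "rho_sigma n t q 1 (rho_alpha n 2 (rho_alpha n 1 (basis_vec 1 2))) (1, 2) = t * q * (q - 1)"
  using n by (simp add: rho_sigma_def rho_alpha_def linear_ext_basis basis_index_def)
     (simp add: basis_vec_def)

text \<open>
  Here sigma_2 acts on v_12, which shares its larger index with the pair (2, 3). The permutations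
  then move the coefficient of v_23 to that of v_13 and further to that of v_12.
\<close>
lemma sigma_alpha_alpha_coefficient:
  assumes n: "n \<ge> 3"
  shows "rho_alpha n 2 (rho_alpha n 1 (rho_sigma n t q 2 (basis_vec 1 2))) (1, 2) = q * (q - 1)"
proof -
  let ?x = "rho_sigma n t q 2 (basis_vec 1 2)"
  have x: "?x \<in> V n" "rho_alpha n 1 ?x \<in> V n"
    using n by (auto intro!: rho_sigma_in_V rho_alpha_in_V basis_vec_in_V simp: basis_index_def)
  have "rho_alpha n 2 (rho_alpha n 1 ?x) (1, 2) = rho_alpha n 1 ?x (1, 3)"
    unfolding rho_alpha_def[of n 2] using n
    by (intro linear_ext_coordinate x) (auto simp: basis_index_def basis_vec_def)
  also have "\<dots> = ?x (2, 3)"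
    unfolding rho_alpha_def[of n 1] using n
    by (intro linear_ext_coordinate x) (auto simp: basis_index_def basis_vec_def)
  also have "\<dots> = q * (q - 1)"
    using n unfolding rho_sigma_def by (subst linear_ext_basis) (auto simp: basis_vec_def basis_index_def)
  finally show ?thesis .
qed

theorem proposition5p2:
  fixes n :: nat
    and \<phi> :: "laurent_tq \<Rightarrow> 'a::comm_ring_1 laurent"
  assumes "n \<ge> 3"
    and "specialization \<phi>"
  shows "(\<exists>\<rho> \<in> hom (conj_aut_group n) (GL n).
            \<forall>i\<in>{1..<n}. \<rho> (sigma n i) = rho_sigma n (\<phi> var_t) (\<phi> var_q) i \<and>
                         \<rho> (alpha n i) = rho_alpha n i)
         \<longleftrightarrow> \<phi> var_t = 1"
proof
  let ?q = "var_q :: 'a laurent" and ?C = "conj_aut_group n"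
  have q: "\<phi> var_q = ?q"
    using assms(2) by (simp add: specialization_def)
  have "?q * Poly_Mapping.single (- 1) 1 = 1"
    by (simp add: var_q_def mult_single)
  then interpret burau_parameter ?q "Poly_Mapping.single (- 1) 1"
    by unfold_locales
  show "\<exists>\<rho> \<in> hom ?C (GL n). \<forall>i\<in>{1..<n}. \<rho> (sigma n i) = rho_sigma n (\<phi> var_t) (\<phi> var_q) i \<and>
      \<rho> (alpha n i) = rho_alpha n i" if "\<phi> var_t = 1"
    unfolding that q
    by (rule bexI[OF _ quadratic_action_burau_hom])
       (simp add: quadratic_action_burau_sigma quadratic_action_burau_alpha)
  assume "\<exists>\<rho> \<in> hom ?C (GL n). \<forall>i\<in>{1..<n}. \<rho> (sigma n i) = rho_sigma n (\<phi> var_t) (\<phi> var_q) i \<and>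
      \<rho> (alpha n i) = rho_alpha n i"
  then obtain \<rho> where hom: "\<rho> \<in> hom ?C (GL n)"
    and sigma: "\<And>i. i \<in> {1..<n} \<Longrightarrow> \<rho> (sigma n i) = rho_sigma n (\<phi> var_t) ?q i"
    and alpha: "\<And>i. i \<in> {1..<n} \<Longrightarrow> \<rho> (alpha n i) = rho_alpha n i"
    unfolding q by blast
  have i: "1 \<in> {1..<n}" "2 \<in> {1..<n}" using assms(1) by auto
  note carrier = i[THEN sigma_in_conj_aut_group] i[THEN alpha_in_conj_aut_group]
  have mult3: "\<rho> (f \<otimes>\<^bsub>?C\<^esub> g \<otimes>\<^bsub>?C\<^esub> h) x = \<rho> h (\<rho> g (\<rho> f x))"
    if "f \<in> carrier ?C" "g \<in> carrier ?C" "h \<in> carrier ?C" "x \<in> V n" for f g h x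
    using hom_mult[OF hom] conj_aut_group_closed[of _ n] that by (simp add: GL_def compose_eq)
  have x: "basis_vec 1 2 \<in> V n"
    using assms(1) by (intro basis_vec_in_V) (simp add: basis_index_def)
  have "rho_sigma n (\<phi> var_t) ?q 1 (rho_alpha n 2 (rho_alpha n 1 (basis_vec 1 2)))
      = rho_alpha n 2 (rho_alpha n 1 (rho_sigma n (\<phi> var_t) ?q 2 (basis_vec 1 2)))"
    using arg_cong[OF alpha_alpha_sigma[OF assms(1)], of "\<lambda>g. \<rho> g (basis_vec 1 2)"]
    by (simp only: mult3 carrier x sigma alpha i)
  from fun_cong[OF this, of "(1, 2)"]
  have "\<phi> var_t * ?q * (?q - 1) = ?q * (?q - 1)"
    unfolding alpha_alpha_sigma_coefficient[OF assms(1)] sigma_alpha_alpha_coefficient[OF assms(1)] .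
  then have "?q * ((?q - 1) * (\<phi> var_t - 1)) = 0"
    by (simp add: algebra_simps)
  then have "Poly_Mapping.single (- 1) 1 * ?q * ((?q - 1) * (\<phi> var_t - 1)) = 0"
    by (simp only: mult.assoc mult_zero_right)
  then have "(?q - 1) * (\<phi> var_t - 1) = 0"
    by (simp add: qi_q)
  then show "\<phi> var_t = 1"
    using var_q_minus_one_cancel by force
qed

end
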